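(* Let $p_1,p_2$ be non-constant polynomials with integer coefficients, taking non-negative values on $\mathbb{N}$, and let $h_1,h_2\ge 1$ be integers. Then for every $x\in\mathbb{R}\setminus\mathbb{Q}$ the set $$\left\{2^{n}\cdot E_{h_1}(p_1(m))\cdot E_{h_2}(p_2(k))\cdot x : n,m,k\in\mathbb{N}\right\}$$ is dense in $\mathbb{R}/\mathbb{Z}$, where $E_h(y)=3^{3^{\cdot^{\cdot^{\cdot^{3^{y}}}}}}$ is the tower containing $h$ threes with $y$ as topmost exponent.
   Context: $\mathbb{N}$ denotes the positive integers. The tower is defined by $E_1(y)=3^y$ and $E_{h+1}(y)=3^{E_h(y)}$. A set of reals is said to be dense in $\mathbb{R}/\mathbb{Z}$ if its image modulo $1$ is dense. *)

theory Defs
  imports "HOL-Analysis.Analysis" "HOL-Computational_Algebra.Polynomial"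
begin

text \<open>
  \<^term>\<open>tower h y\<close> contains \<open>h\<close> threes with \<open>y\<close> as topmost exponent. It is only used for
  \<open>h \<ge> 1\<close>; starting the recursion at \<open>tower 0 y = y\<close> gives \<open>tower 1 y = 3 ^ y\<close>.
\<close>

primrec tower :: "nat \<Rightarrow> nat \<Rightarrow> nat" where
  "tower 0 y = y"
| "tower (Suc h) y = 3 ^ tower h y"

lemma tower_1: "tower 1 y = 3 ^ y"
  by simp

definition mod_one_rel :: "(real \<times> real) set" where
  "mod_one_rel = {(x, y). x - y \<in> \<int>}"

definition mod_one :: "real \<Rightarrow> real set" where
  "mod_one x = mod_one_rel `` {x}"

lemma equiv_mod_one_rel: "equiv UNIV mod_one_rel"
proof (rule equivI)
  show "sym mod_one_rel"
    unfolding sym_def mod_one_rel_def using minus_in_Ints_iff by fastforce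
  show "trans mod_one_rel"
    unfolding trans_def mod_one_rel_def using Ints_add by fastforce
qed (auto simp: mod_one_rel_def refl_on_def)

text \<open>The quotient topology on the set of cosets \<open>\<real>/\<int>\<close>.\<close>

definition circle_topology :: "real set topology" where
  "circle_topology = topology (\<lambda>U. U \<subseteq> UNIV // mod_one_rel \<and> open (mod_one -` U))"

definition dense_mod_one :: "real set \<Rightarrow> bool" where
  "dense_mod_one S \<longleftrightarrow> circle_topology closure_of (mod_one ` S) = topspace circle_topology"

lemma openin_circle_topology:
  "openin circle_topology U \<longleftrightarrow> U \<subseteq> UNIV // mod_one_rel \<and> open (mod_one -` U)"
proof -
  have "istopology (\<lambda>U. U \<subseteq> UNIV // mod_one_rel \<and> open (mod_one -` U))"
    unfolding istopology_def by (auto simp: vimage_Int vimage_Union intro!: open_Int open_UN)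
  then show ?thesis
    by (simp add: circle_topology_def topology_inverse')
qed

lemma range_mod_one: "range mod_one = UNIV // mod_one_rel"
  by (auto simp: quotient_def mod_one_def)

lemma topspace_circle_topology: "topspace circle_topology = UNIV // mod_one_rel"
proof -
  have "mod_one -` (UNIV // mod_one_rel) = UNIV"
    by (auto simp flip: range_mod_one)
  then have "openin circle_topology (UNIV // mod_one_rel)"
    by (simp add: openin_circle_topology)
  then show ?thesis
    unfolding topspace_def by (auto simp: openin_circle_topology)
qed

lemma quotient_map_mod_one: "quotient_map euclidean circle_topology mod_one"
  by (auto simp: quotient_map_def topspace_circle_topology openin_circle_topology range_mod_one
      vimage_def)

end

theory Submission
  imports Defs "HOL-Library.Real_Mod"
begin

text \<open>
  The argument only uses that the multipliers \<open>s\<^sub>i = E\<^bsub>h\<^esub>(p(m\<^sub>i))\<close>, along a suitable progression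
  \<open>m\<^sub>i\<close>, fill a positive proportion of the residues modulo \<open>2\<^sup>N\<close> uniformly in \<open>N\<close>; this follows from the
  \<open>2\<close>-adic valuations of \<open>p(a) - p(b)\<close> and \<open>3\<^sup>a - 3\<^sup>b\<close>.

  Doubling is not injective near the end of an irrational orbit, so the orbit of \<open>x\<close> contains
  \<open>y, y'\<close> with \<open>y - y'\<close> arbitrarily close to \<open>j / 2\<^sup>N\<close>, \<open>j\<close> odd. The differences \<open>s\<^sub>i y - s\<^sub>i y'\<close> are then
  almost \<open>s\<^sub>i j / 2\<^sup>N\<close>, and there are about \<open>2\<^sup>N\<close> of them; hence \<open>C = {2\<^sup>n s\<^sub>i x}\<close> occupies at least about
  \<open>2\<^bsup>N/2\<^esup>\<close> dyadic intervals of length \<open>2\<^bsup>-N\<^esup>\<close>. As this growth is exponential and \<open>C\<close> is invariant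
  under doubling, for every \<open>M\<close> there are \<open>N\<close>, \<open>u\<close> and a set \<open>J\<close> of \<open>M\<close> residues such that \<open>C\<close> comes
  as close as desired to all \<open>(u + j) / 2\<^sup>N\<close>, \<open>j \<in> J\<close>. Finally, as in the large
  sieve, the sum of \<open>|\<Sum>\<^sub>j e(t j / 2\<^sup>N)|\<^sup>2\<close> over the multipliers \<open>t\<close> of the second family is bounded by the
  sum over all residues, which is \<open>2\<^sup>N M\<close>; for large \<open>M\<close> this forces the points \<open>t (u + j) / 2\<^sup>N\<close> to be
  \<open>\<epsilon>\<close>-dense modulo \<open>1\<close>.
\<close>

section \<open>Multipliers that spread out modulo powers of two\<close>

text \<open>For i different from j this bounds the 2-adic valuation of \<open>s i - s j\<close> by
  that of \<open>i - j\<close> plus c. Hence \<open>2 ^ N\<close> consecutive indices give distinct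
  residues modulo \<open>2 ^ (N + c)\<close>, a proportion \<open>2 ^ -c\<close> of them uniformly
  in N.\<close>

definition two_adically_spread :: "nat \<Rightarrow> (nat \<Rightarrow> nat) \<Rightarrow> bool" where
  "two_adically_spread c s \<longleftrightarrow>
    (\<forall>N i j. (2::int) ^ (N + c) dvd int (s i) - int (s j) \<longrightarrow> 2 ^ N dvd int i - int j)"

section \<open>Powers and towers of three modulo powers of two\<close>

lemma three_power_mod_8: "\<exists>q. (3::int) ^ d = 8 * q + (if even d then 1 else 3)"
proof (induction d)
  case (Suc d)
  then obtain q where q: "(3::int) ^ d = 8 * q + (if even d then 1 else 3)" by blast
  have "(3::int) ^ Suc d = 8 * (if even d then 3 * q else 3 * q + 1) + (if even (Suc d) then 1 else 3)"
    using q by simp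
  then show ?case by blast
qed (auto intro: exI[of _ 0])

lemma two_power_dvd_mult_odd:
  fixes a b :: int
  assumes "odd b" "2 ^ n dvd a * b"
  shows "2 ^ n dvd a"
  using assms by (simp add: coprime_dvd_mult_left_iff)

text \<open>Lifting the exponent by halving: with d = 2e, 3^d - 1 = (3^e - 1)(3^e + 1). For even e
  the second factor is twice an odd number, so each halving of d costs one factor of two. For odd e
  the product is 8 times an odd number, and the descent stops.\<close>

lemma two_power_dvd_three_power_minus_1:
  assumes "(2::int) ^ (N + 2) dvd 3 ^ d - 1"
  shows "2 ^ N dvd d"
  using assms
proof (induction N arbitrary: d)
  case (Suc N)
  have "(8::int) dvd 3 ^ d - 1"
    using Suc.prems by (rule dvd_trans[rotated]) (simp add: numeral_eq_Suc)
  moreover obtain q where "(3::int) ^ d = 8 * q + (if even d then 1 else 3)"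
    using three_power_mod_8 by blast
  ultimately have "even d" by presburger
  then obtain e where e: "d = 2 * e" by blast
  have fac: "(3::int) ^ d - 1 = (3 ^ e - 1) * (3 ^ e + 1)"
    unfolding e power_even_eq by (simp add: power2_eq_square algebra_simps)
  show ?case
  proof (cases "even e")
    case True
    then obtain q where q: "(3::int) ^ e = 8 * q + 1"
      using three_power_mod_8[of e] by auto
    then have "(3::int) ^ d - 1 = 2 * ((3 ^ e - 1) * (4 * q + 1))"
      unfolding fac q by (simp add: algebra_simps)
    with Suc.prems have "2 * (2::int) ^ (N + 2) dvd 2 * ((3 ^ e - 1) * (4 * q + 1))"
      by (simp only: power_Suc add_Suc)
    then have "(2::int) ^ (N + 2) dvd (3 ^ e - 1) * (4 * q + 1)"
      by (simp only: dvd_mult_cancel_left) simp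
    then have "(2::int) ^ (N + 2) dvd 3 ^ e - 1"
      by (rule two_power_dvd_mult_odd[rotated]) simp
    then show ?thesis using Suc.IH e by simp
  next
    case False
    then obtain q where q: "(3::int) ^ e = 8 * q + 3"
      using three_power_mod_8[of e] by auto
    then have "(3::int) ^ d - 1 = 8 * ((4 * q + 1) * (2 * q + 1))"
      unfolding fac q by (simp add: algebra_simps)
    moreover have "(2::int) ^ (Suc N + 2) = 8 * 2 ^ N" by simp
    ultimately have "(8::int) * 2 ^ N dvd 8 * ((4 * q + 1) * (2 * q + 1))"
      using Suc.prems by (simp only:)
    then have "2 ^ N dvd (4 * q + 1) * (2 * q + 1)"
      by (simp only: dvd_mult_cancel_left) simp
    then have "N = 0" by (cases N) (auto dest: dvd_mult_left)
    then show ?thesis using e by simp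
  qed
qed simp

lemma two_power_dvd_three_power_diff:
  assumes "(2::int) ^ (N + 2) dvd 3 ^ a - 3 ^ b"
  shows "2 ^ N dvd int a - int b"
  using assms
proof (induction a b rule: linorder_wlog)
  case (le a b)
  have "(3::int) ^ a - 3 ^ b = - ((3 ^ (b - a) - 1) * 3 ^ a)"
    using le by (simp add: algebra_simps flip: power_add)
  with le have "(2::int) ^ (N + 2) dvd (3 ^ (b - a) - 1) * 3 ^ a"
    by (simp only: dvd_minus_iff)
  then have "(2::int) ^ (N + 2) dvd 3 ^ (b - a) - 1"
    by (rule two_power_dvd_mult_odd[rotated]) simp
  then have "2 ^ N dvd b - a"
    by (rule two_power_dvd_three_power_minus_1)
  then have "int (2 ^ N) dvd int (b - a)"
    by (simp only: int_dvd_int_iff)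
  then show ?case
    using le by (simp add: of_nat_diff dvd_diff_commute)
qed (simp add: dvd_diff_commute)

text \<open>Each of the h exponentiations costs two factors of two.\<close>

lemma two_power_dvd_tower_diff:
  assumes "(2::int) ^ (N + 2 * h) dvd int (tower h a) - int (tower h b)"
  shows "2 ^ N dvd int a - int b"
  using assms
proof (induction h)
  case (Suc h)
  have "N + 2 * Suc h = (N + 2 * h) + 2" by simp
  with Suc.prems have "(2::int) ^ ((N + 2 * h) + 2) dvd 3 ^ tower h a - 3 ^ tower h b"
    by (simp only: tower.simps of_nat_power of_nat_numeral)
  then show ?case
    using Suc.IH two_power_dvd_three_power_diff by blast
qed simp

section \<open>Polynomial values along an arithmetic progression\<close>

text \<open>The remainder is kept as a multiple of \<open>d ^ 2\<close> with cofactor in the ring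
  itself, without the division by 2 of the usual Taylor formula, so that it can be used for
  divisibility.\<close>

lemma poly_taylor_2:
  fixes p :: "'a::idom poly"
  shows "\<exists>w. poly p (b + d) = poly p b + d * poly (pderiv p) b + d ^ 2 * w"
proof (induction p)
  case (pCons a p)
  then obtain w where "poly p (b + d) = poly p b + d * poly (pderiv p) b + d ^ 2 * w" by blast
  then have "poly (pCons a p) (b + d) = poly (pCons a p) b + d * poly (pderiv (pCons a p)) b +
      d ^ 2 * (poly (pderiv p) b + (b + d) * w)"
    by (simp add: pderiv_pCons algebra_simps power2_eq_square)
  then show ?case by blast
qed simp

text \<open>With b, b + d in the progression, p(b + d) - p(b) = d (p'(b) + d w). If p'(m0) is
  nonzero of valuation v, the step \<open>2 ^ (v + 1)\<close> is fine enough that p' keeps valuation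
  v along the whole progression and that d w does not disturb it. The loss is v from the derivative
  and v + 1 from the step.\<close>

lemma poly_two_adic_expansion:
  fixes p :: "int poly"
  assumes "degree p > 0"
  obtains m0 e c :: nat where "m0 \<ge> 1"
    "\<And>N i j. (2::int) ^ (N + c) dvd poly p (int (m0 + 2 ^ e * i)) - poly p (int (m0 + 2 ^ e * j)) \<Longrightarrow>
      2 ^ N dvd int i - int j"
proof -
  have "pderiv p \<noteq> 0" using assms by (simp add: pderiv_eq_0_iff)
  then have "finite {z. poly (pderiv p) z = 0}" by (rule poly_roots_finite)
  then have "finite (int -` {z. poly (pderiv p) z = 0})" by (intro finite_vimageI) auto
  then have "\<exists>m0. m0 \<notin> insert 0 (int -` {z. poly (pderiv p) z = 0})"
    by (intro ex_new_if_finite) auto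
  then obtain m0 where m0: "m0 \<noteq> 0" "poly (pderiv p) (int m0) \<noteq> 0" by auto
  define v where "v = multiplicity 2 (poly (pderiv p) (int m0))"
  obtain q where q: "poly (pderiv p) (int m0) = 2 ^ v * q" "odd q"
    using multiplicity_decompose'[OF m0(2), of 2] unfolding v_def by auto
  have "2 ^ N dvd int i - int j"
    if *: "(2::int) ^ (N + (v + (v + 1))) dvd
      poly p (int (m0 + 2 ^ (v + 1) * i)) - poly p (int (m0 + 2 ^ (v + 1) * j))" for N i j
  proof -
    let ?d = "2 ^ (v + 1) * (int i - int j)"
    let ?b = "int (m0 + 2 ^ (v + 1) * j)"
    obtain w where w: "poly p (?b + ?d) = poly p ?b + ?d * poly (pderiv p) ?b + ?d ^ 2 * w"
      using poly_taylor_2 by blast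
    obtain w' where w': "poly (pderiv p) (int m0 + 2 ^ (v + 1) * int j) = poly (pderiv p) (int m0) +
        2 ^ (v + 1) * int j * poly (pderiv (pderiv p)) (int m0) + (2 ^ (v + 1) * int j) ^ 2 * w'"
      using poly_taylor_2 by blast
    \<comment> \<open>The second bracket is even and q is odd, so the valuation of p' at
      \<open>?b\<close> is still v.\<close>
    have "poly (pderiv p) ?b = 2 ^ v * (q + 2 * (int j * poly (pderiv (pderiv p)) (int m0) +
        int j * (2 ^ (v + 1) * int j * w')))"
      using w' by (simp add: q power2_eq_square algebra_simps)
    then obtain r where r: "poly (pderiv p) ?b = 2 ^ v * (q + 2 * r)" by blast
    have "?b + ?d = int (m0 + 2 ^ (v + 1) * i)" by (simp add: algebra_simps)
    then have "poly p (int (m0 + 2 ^ (v + 1) * i)) - poly p ?b = ?d * poly (pderiv p) ?b + ?d ^ 2 * w"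
      using w by (simp only:)
    also have "\<dots> = 2 ^ (v + (v + 1)) * ((int i - int j) * (q + 2 * (r + (int i - int j) * w)))"
      unfolding r by (simp add: power2_eq_square power_add algebra_simps)
    finally have "(2::int) ^ (v + (v + 1)) * 2 ^ N dvd
        2 ^ (v + (v + 1)) * ((int i - int j) * (q + 2 * (r + (int i - int j) * w)))"
      using * by (simp only: power_add mult_ac)
    then have "2 ^ N dvd (int i - int j) * (q + 2 * (r + (int i - int j) * w))"
      by (simp only: dvd_mult_cancel_left) simp
    then show ?thesis
      by (rule two_power_dvd_mult_odd[rotated]) (use q in simp)
  qed
  then show thesis using that[of m0 "v + (v + 1)" "v + 1"] m0 by simp
qed

lemma tower_poly_two_adically_spread:
  fixes p :: "int poly"
  assumes "degree p > 0" "\<And>m::nat. m \<ge> 1 \<Longrightarrow> poly p (int m) \<ge> 0"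
  obtains c m where "\<And>i. m i \<ge> (1::nat)"
    "two_adically_spread c (\<lambda>i. tower h (nat (poly p (int (m i)))))"
proof -
  obtain m0 e c :: nat where m0: "m0 \<ge> 1" and
    c: "\<And>N i j. (2::int) ^ (N + c) dvd poly p (int (m0 + 2 ^ e * i)) - poly p (int (m0 + 2 ^ e * j)) \<Longrightarrow>
      2 ^ N dvd int i - int j"
    by (rule poly_two_adic_expansion[OF assms(1)], erule that, assumption)
  let ?m = "\<lambda>i. m0 + 2 ^ e * i"
  have "2 ^ N dvd int i - int j"
    if "(2::int) ^ (N + (c + 2 * h)) dvd int (tower h (nat (poly p (int (?m i))))) -
      int (tower h (nat (poly p (int (?m j)))))" for N i j
  proof -
    have "(2::int) ^ (N + c) dvd int (nat (poly p (int (?m i)))) - int (nat (poly p (int (?m j))))"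
      by (rule two_power_dvd_tower_diff[of _ h]) (use that in \<open>simp only: add.assoc\<close>)
    also have "\<dots> = poly p (int (?m i)) - poly p (int (?m j))"
      using assms(2)[of "?m i"] assms(2)[of "?m j"] m0 by simp
    finally show ?thesis by (rule c)
  qed
  then have "two_adically_spread (c + 2 * h) (\<lambda>i. tower h (nat (poly p (int (?m i)))))"
    unfolding two_adically_spread_def by blast
  then show thesis using that[of ?m] m0 by simp
qed

section \<open>An exponential sum estimate\<close>

text \<open>The additive character usually written e(\<theta>).\<close>

definition unit_char :: "real \<Rightarrow> complex" where
  "unit_char \<theta> = cis (2 * pi * \<theta>)"

lemma norm_unit_char [simp]: "norm (unit_char \<theta>) = 1"
  by (simp add: unit_char_def)

lemma unit_char_0 [simp]: "unit_char 0 = 1"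
  by (simp add: unit_char_def)

lemma unit_char_add: "unit_char (a + b) = unit_char a * unit_char b"
  by (simp add: unit_char_def cis_mult distrib_left)

lemma unit_char_power: "unit_char a ^ n = unit_char (real n * a)"
  by (simp only: unit_char_def Complex.DeMoivre) (simp add: mult_ac)

lemma cnj_unit_char: "cnj (unit_char a) = unit_char (- a)"
  by (simp add: unit_char_def cis_cnj)

lemma unit_char_eq_1_iff: "unit_char a = 1 \<longleftrightarrow> a \<in> \<int>"
proof -
  have "2 * pi * a = of_int n * (2 * pi) \<longleftrightarrow> a = of_int n" for n
    by auto
  then show ?thesis
    by (auto simp: unit_char_def cis_eq_1_iff elim!: Ints_cases)
qed

lemma unit_char_add_int [simp]: "unit_char (a + of_int k) = unit_char a"
  using unit_char_eq_1_iff[of "of_int k"] by (simp add: unit_char_add)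

section \<open>Orthogonality modulo q and a large sieve bound\<close>

lemma of_int_divide_in_Ints_iff_dvd:
  fixes d q :: int
  assumes "q \<noteq> 0"
  shows "real_of_int d / real_of_int q \<in> \<int> \<longleftrightarrow> q dvd d"
proof
  assume "real_of_int d / real_of_int q \<in> \<int>"
  then obtain k where "real_of_int d / real_of_int q = of_int k" by (auto elim: Ints_cases)
  then have "real_of_int d = of_int (q * k)" using assms by (simp add: field_simps)
  then have "d = q * k" by (simp only: of_int_eq_iff)
  then show "q dvd d" by simp
qed (use assms in auto)

lemma sum_unit_char_residues:
  assumes "q > 0"
  shows "(\<Sum>r<q. unit_char (real r * (of_int d / real q))) = (if int q dvd d then of_nat q else 0)"
proof -
  let ?z = "unit_char (of_int d / real q)"
  have eq: "(\<Sum>r<q. unit_char (real r * (of_int d / real q))) = (\<Sum>r<q. ?z ^ r)"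
    by (simp add: unit_char_power)
  have one: "?z = 1 \<longleftrightarrow> int q dvd d"
    using of_int_divide_in_Ints_iff_dvd[of "int q" d] assms by (simp add: unit_char_eq_1_iff)
  have "?z ^ q = 1"
    using assms by (simp add: unit_char_power unit_char_eq_1_iff)
  then show ?thesis
    unfolding eq using one by (auto simp: sum_gp_strict)
qed

text \<open>Parseval: expanding the square and summing over r first leaves only the congruent pairs.
  They are counted rather than assumed diagonal because f will be multiplication by a frequency that
  may be even.\<close>

lemma sum_norm_square_unit_char_residues:
  fixes f :: "'a \<Rightarrow> int"
  assumes "finite J" "q > 0"
  shows "(\<Sum>r<q. (norm (\<Sum>j\<in>J. unit_char (real r * of_int (f j) / real q)))\<^sup>2) =
    real q * real (card {(j, k) \<in> J \<times> J. int q dvd f j - f k})"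
proof -
  have "complex_of_real (\<Sum>r<q. (norm (\<Sum>j\<in>J. unit_char (real r * of_int (f j) / real q)))\<^sup>2) =
    (\<Sum>r<q. \<Sum>j\<in>J. \<Sum>k\<in>J. unit_char (real r * (of_int (f j - f k) / real q)))"
    by (simp only: of_real_sum complex_norm_square cnj_sum sum_product cnj_unit_char
        flip: unit_char_add) (simp add: diff_divide_distrib algebra_simps)
  also have "\<dots> = (\<Sum>j\<in>J. \<Sum>r<q. \<Sum>k\<in>J. unit_char (real r * (of_int (f j - f k) / real q)))"
    by (rule sum.swap)
  also have "\<dots> = (\<Sum>j\<in>J. \<Sum>k\<in>J. \<Sum>r<q. unit_char (real r * (of_int (f j - f k) / real q)))"
    by (intro sum.cong refl sum.swap)
  also have "\<dots> = (\<Sum>j\<in>J. \<Sum>k\<in>J. if int q dvd f j - f k then of_nat q else 0)"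
    by (simp only: sum_unit_char_residues[OF assms(2)])
  also have "\<dots> = (\<Sum>(j, k)\<in>J \<times> J. if int q dvd f j - f k then of_nat q else 0)"
    by (simp add: sum.cartesian_product)
  also have "\<dots> = (\<Sum>(j, k)\<in>{(j, k) \<in> J \<times> J. int q dvd f j - f k}. of_nat q)"
    by (rule sum.mono_neutral_cong_right) (use assms in \<open>auto split: if_splits\<close>)
  also have "\<dots> = complex_of_real (real q * real (card {(j, k) \<in> J \<times> J. int q dvd f j - f k}))"
    by (simp add: case_prod_beta)
  finally show ?thesis by (simp only: of_real_eq_iff)
qed

text \<open>A nonzero q of modulus below \<open>2 ^ w\<close> contains fewer than w factors of two,
  so it accounts for fewer than w of the N factors. For w > N truncated subtraction makes the claim
  trivial.\<close>

lemma two_power_dvd_mult_small: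
  fixes q d :: int
  assumes "2 ^ N dvd q * d" "q \<noteq> 0" "\<bar>q\<bar> < 2 ^ w"
  shows "2 ^ (N - w) dvd d"
proof -
  define v where "v = multiplicity 2 q"
  obtain r where r: "q = 2 ^ v * r" "odd r"
    using multiplicity_decompose'[OF assms(2), of 2] unfolding v_def by auto
  have "2 ^ v \<le> \<bar>q\<bar>"
    using assms(2) by (intro zdvd_imp_le) (auto simp: r)
  then have "(2::int) ^ v < 2 ^ w" using assms(3) by linarith
  then have vw: "v < w" by simp
  show ?thesis
  proof (cases "w \<le> N")
    case True
    then have "(2::int) ^ N = 2 ^ v * 2 ^ (N - v)" using vw by (simp flip: power_add)
    then have "(2::int) ^ v * 2 ^ (N - v) dvd 2 ^ v * (d * r)"
      using assms(1) by (simp add: r mult_ac)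
    then have "2 ^ (N - v) dvd d * r" by (simp only: dvd_mult_cancel_left) simp
    then have "2 ^ (N - v) dvd d" using two_power_dvd_mult_odd[OF r(2)] by blast
    then show ?thesis by (rule dvd_trans[rotated]) (use vw in \<open>simp add: le_imp_power_dvd\<close>)
  qed simp
qed

text \<open>In a congruent pair, j determines k modulo \<open>2 ^ (N - w)\<close>, so the pair is
  determined by j and the quotient of k by that modulus, which takes at most \<open>2 ^ w\<close>
  values.\<close>

lemma card_congruent_pairs_le:
  fixes J :: "nat set" and q :: int
  assumes J: "J \<subseteq> {..<2 ^ N}" and q: "q \<noteq> 0" "\<bar>q\<bar> < 2 ^ w"
  shows "card {(j, k) \<in> J \<times> J. int (2 ^ N) dvd q * int j - q * int k} \<le> card J * 2 ^ w"
proof -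
  have fin: "finite J" using J by (rule finite_subset) simp
  let ?m = "2 ^ (N - w) :: nat"
  let ?g = "\<lambda>(j, k). (j, k div ?m)"
  let ?A = "{(j, k) \<in> J \<times> J. int (2 ^ N) dvd q * int j - q * int k}"
  have mod: "j mod ?m = k mod ?m" if "(j, k) \<in> ?A" for j k
  proof -
    have "2 ^ N dvd q * (int j - int k)" using that by (simp add: right_diff_distrib)
    then have "2 ^ (N - w) dvd int j - int k" by (rule two_power_dvd_mult_small) (use q in auto)
    then have "int j mod int ?m = int k mod int ?m" by (simp add: mod_eq_dvd_iff)
    then show ?thesis by (simp only: of_nat_mod[symmetric] of_nat_eq_iff)
  qed
  have "inj_on ?g ?A"
  proof (rule inj_onI)
    fix x y assume xy: "x \<in> ?A" "y \<in> ?A" "?g x = ?g y"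
    obtain j k j' k' where x: "x = (j, k)" and y: "y = (j', k')" by (cases x; cases y) simp
    from xy(3) have j: "j = j'" and k: "k div ?m = k' div ?m" unfolding x y by auto
    have "k mod ?m = k' mod ?m"
      using mod[OF xy(1)[unfolded x]] mod[OF xy(2)[unfolded y]] j by (simp only:)
    then have "k = k'" using k by (metis mult_div_mod_eq)
    then show "x = y" using x y j by simp
  qed
  moreover have "?g ` ?A \<subseteq> J \<times> {..<2 ^ w}"
  proof safe
    fix j k assume "j \<in> J" "k \<in> J"
    then have "k < 2 ^ N" using J by auto
    also have "2 ^ N \<le> 2 ^ w * ?m" by (simp flip: power_add)
    finally have "k div ?m < 2 ^ w" by (simp add: less_mult_imp_div_less)
    then show "k div ?m < 2 ^ w" .
  qed
  ultimately have "card ?A \<le> card (J \<times> {..<2 ^ w :: nat})"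
    by (intro card_inj_on_le) (use fin in auto)
  then show ?thesis by (simp add: card_cartesian_product)
qed

lemma unit_char_mod_residue:
  assumes "q > 0"
  shows "unit_char (real (t mod q) * of_int a / real q) = unit_char (real t * of_int a / real q)"
proof -
  have "real t = real (t mod q) + real q * real (t div q)"
    by (metis mod_mult_div_eq of_nat_add of_nat_mult)
  then have "real t * of_int a / real q = real (t mod q) * of_int a / real q + of_int (int (t div q) * a)"
    using assms by (simp add: field_simps)
  then show ?thesis by (simp only: unit_char_add_int)
qed

text \<open>The shift \<open>\<beta> t\<close> only contributes a factor of modulus 1.
  Cauchy-Schwarz over t, then enlarging T to all residues and Parseval, give the bound; it beats the
  trivial one when J is large and T fills a fixed proportion of the residues.\<close>

lemma norm_sum_unit_char_le:
  fixes J T :: "nat set" and q :: int and \<beta> :: "nat \<Rightarrow> real"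
  assumes J: "J \<subseteq> {..<2 ^ N}" and q: "q \<noteq> 0" "\<bar>q\<bar> < 2 ^ w"
    and T: "finite T" "inj_on (\<lambda>t. t mod 2 ^ N) T"
  shows "norm (\<Sum>t\<in>T. \<Sum>j\<in>J. unit_char (of_int q * (\<beta> t + real t * real j / 2 ^ N))) \<le>
    sqrt (real (card T) * 2 ^ N * real (card J) * 2 ^ w)"
proof -
  have fin: "finite J" using J by (rule finite_subset) simp
  define A where "A r = norm (\<Sum>j\<in>J. unit_char (real r * of_int (q * int j) / real (2 ^ N)))" for r :: nat
  have A_mod: "A (t mod 2 ^ N) = A t" for t
    
    by (simp only: A_def unit_char_mod_residue[of "2 ^ N", OF zero_less_power[OF zero_less_numeral]])
  have eq: "norm (\<Sum>j\<in>J. unit_char (of_int q * (\<beta> t + real t * real j / 2 ^ N))) = A t" for t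
  proof -
    have "(\<Sum>j\<in>J. unit_char (of_int q * (\<beta> t + real t * real j / 2 ^ N))) =
        unit_char (of_int q * \<beta> t) * (\<Sum>j\<in>J. unit_char (real t * of_int (q * int j) / real (2 ^ N)))"
      by (simp add: sum_distrib_left distrib_left mult_ac flip: unit_char_add)
    then show ?thesis by (simp add: norm_mult A_def)
  qed
  have "norm (\<Sum>t\<in>T. \<Sum>j\<in>J. unit_char (of_int q * (\<beta> t + real t * real j / 2 ^ N))) \<le> (\<Sum>t\<in>T. A t)"
    by (rule sum_norm_le) (simp add: eq)
  also have "\<dots> \<le> sqrt ((\<Sum>t\<in>T. A t)\<^sup>2)" by simp
  also have "\<dots> \<le> sqrt ((\<Sum>t\<in>T. (A t)\<^sup>2) * real (card T))"
    by (intro real_sqrt_le_mono sum_squared_le_sum_of_squares)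
  also have "\<dots> \<le> sqrt ((2 ^ N * (real (card J) * 2 ^ w)) * real (card T))"
  proof (intro real_sqrt_le_mono mult_right_mono)
    have "(\<Sum>t\<in>T. (A t)\<^sup>2) = (\<Sum>r\<in>(\<lambda>t. t mod 2 ^ N) ` T. (A r)\<^sup>2)"
      using T(2) by (simp add: sum.reindex A_mod)
    also have "\<dots> \<le> (\<Sum>r<2 ^ N. (A r)\<^sup>2)"
      by (rule sum_mono2) auto
    also have "\<dots> = real (2 ^ N) *
        real (card {(j, k) \<in> J \<times> J. int (2 ^ N) dvd q * int j - q * int k})"
      unfolding A_def by (rule sum_norm_square_unit_char_residues) (use fin in auto)
    also have "\<dots> \<le> real (2 ^ N) * real (card J * 2 ^ w)"
      by (intro mult_left_mono of_nat_mono card_congruent_pairs_le[OF J q]) simp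
    finally show "(\<Sum>t\<in>T. (A t)\<^sup>2) \<le> 2 ^ N * (real (card J) * 2 ^ w)" by simp
  qed simp
  finally show ?thesis by (simp add: mult_ac)
qed

text \<open>The trigonometric polynomial \<open>(2 + 2 cos 2\<pi>\<theta>)\<^sup>K\<close> is the test function that detects
  the points near \<open>0\<close>.\<close>

lemma power_cos_eq_sum_unit_char:
  "complex_of_real ((2 + 2 * cos (2 * pi * \<theta>)) ^ K) =
    (\<Sum>a\<le>K. \<Sum>b\<le>K. of_nat (K choose a) * of_nat (K choose b) * unit_char (of_int (int a - int b) * \<theta>))"
proof -
  have char: "unit_char (of_int (int a - int b) * \<theta>) = unit_char \<theta> ^ a * unit_char (- \<theta>) ^ b" for a b
    by (simp add: unit_char_power left_diff_distrib flip: unit_char_add)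
  \<comment> \<open>Both sides are the squared modulus of e(\<theta>) + 1.\<close>
  have "complex_of_real (2 + 2 * cos (2 * pi * \<theta>)) = (unit_char \<theta> + 1) * (unit_char (- \<theta>) + 1)"
    by (simp add: unit_char_def cis_mult distrib_right distrib_left complex_eq_iff)
  then have "complex_of_real ((2 + 2 * cos (2 * pi * \<theta>)) ^ K) =
      (unit_char \<theta> + 1) ^ K * (unit_char (- \<theta>) + 1) ^ K"
    by (simp add: power_mult_distrib of_real_power)
  also have "\<dots> = (\<Sum>a\<le>K. of_nat (K choose a) * unit_char \<theta> ^ a) *
      (\<Sum>b\<le>K. of_nat (K choose b) * unit_char (- \<theta>) ^ b)"
    by (simp add: binomial_ring)
  also have "\<dots> = (\<Sum>a\<le>K. \<Sum>b\<le>K. of_nat (K choose a) * of_nat (K choose b) *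
      unit_char (of_int (int a - int b) * \<theta>))"
    unfolding sum_product
    by (intro sum.cong refl) (simp only: char, simp only: mult_ac)
  finally show ?thesis .
qed

lemma cos_le_cos_if_far_from_Ints:
  assumes "0 \<le> \<epsilon>" "\<epsilon> \<le> 1 / 2" "\<And>k::int. \<epsilon> \<le> \<bar>\<theta> - of_int k\<bar>"
  shows "cos (2 * pi * \<theta>) \<le> cos (2 * pi * \<epsilon>)"
proof -
  let ?d = "\<bar>\<theta> - of_int (round \<theta>)\<bar>"
  have d: "?d \<le> 1 / 2" using of_int_round_abs_le[of \<theta>] by (simp add: abs_minus_commute)
  have "cos (2 * pi * \<theta>) = cos (2 * pi * (\<theta> - of_int (round \<theta>)))"
    by (simp add: right_diff_distrib cos_diff)
  also have "\<dots> = cos (2 * pi * ?d)"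
    by (metis abs_mult abs_numeral abs_of_pos cos_abs_real pi_gt_zero)
  also have "\<dots> \<le> cos (2 * pi * \<epsilon>)"
    using d assms by (intro cos_monotone_0_pi_le) auto
  finally show ?thesis .
qed

lemma sum_binomial: "(\<Sum>a\<le>K. real (K choose a)) = 2 ^ K"
  using choose_row_sum[of K] by (metis of_nat_numeral of_nat_power of_nat_sum)

text \<open>Cauchy-Schwarz. The sum of squares is the constant term, that is the mean, of the test
  function.\<close>

lemma sum_binomial_squares_ge: "4 ^ K / real (K + 1) \<le> (\<Sum>a\<le>K. (real (K choose a))\<^sup>2)"
proof -
  have "(4::real) ^ K = (\<Sum>a\<le>K. real (K choose a))\<^sup>2"
    by (simp add: sum_binomial power2_eq_square flip: power_mult_distrib)
  also have "\<dots> \<le> (\<Sum>a\<le>K. (real (K choose a))\<^sup>2) * real (card {..K})"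
    by (rule sum_squared_le_sum_of_squares)
  finally show ?thesis by (simp add: divide_le_eq)
qed

text \<open>The frequency a - b = 0 gives the main term. Every other frequency is nonzero of modulus
  at most K < \<open>2 ^ K\<close>, so the large sieve bound applies with w = K; the binomial
  weights add up to \<open>4 ^ K\<close>.\<close>

lemma sum_power_cos_ge:
  fixes J T :: "nat set" and \<beta> :: "nat \<Rightarrow> real"
  assumes J: "J \<subseteq> {..<2 ^ N}" and T: "finite T" "inj_on (\<lambda>t. t mod 2 ^ N) T"
  shows "(\<Sum>t\<in>T. \<Sum>j\<in>J. (2 + 2 * cos (2 * pi * (\<beta> t + real t * real j / 2 ^ N))) ^ K) \<ge>
    4 ^ K * (real (card T) * real (card J) / real (K + 1) -
      sqrt (real (card T) * 2 ^ N * real (card J) * 2 ^ K))"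
proof -
  define \<theta> where "\<theta> t j = \<beta> t + real t * real j / 2 ^ N" for t j :: nat
  define W where "W q = (\<Sum>t\<in>T. \<Sum>j\<in>J. unit_char (of_int q * \<theta> t j))" for q
  define B where "B = sqrt (real (card T) * 2 ^ N * real (card J) * 2 ^ K)"
  define c where "c a b = real (K choose a) * real (K choose b)" for a b
  define S where "S = (\<Sum>t\<in>T. \<Sum>j\<in>J. (2 + 2 * cos (2 * pi * \<theta> t j)) ^ K)"
  define D where "D = real (card T) * real (card J) * (\<Sum>a\<le>K. (real (K choose a))\<^sup>2)"
  have W0: "W 0 = of_real (real (card T) * real (card J))"
    by (simp add: W_def)
  have "B \<ge> 0" by (simp add: B_def)
  have W_le: "norm (W (int a - int b) - (if a = b then W 0 else 0)) \<le> B" if "a \<le> K" "b \<le> K" for a b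
  proof (cases "a = b")
    case False
    have "int K < 2 ^ K" by (metis of_nat_less_iff of_nat_less_two_power of_nat_numeral of_nat_power)
    then have "int a - int b \<noteq> 0" "\<bar>int a - int b\<bar> < 2 ^ K"
      using that False by linarith+
    then show ?thesis
      unfolding W_def \<theta>_def B_def using False norm_sum_unit_char_le[OF J _ _ T, of "int a - int b" K \<beta>]
      by simp
  qed (use \<open>B \<ge> 0\<close> in simp)
  have "complex_of_real S = (\<Sum>t\<in>T. \<Sum>j\<in>J. \<Sum>a\<le>K. \<Sum>b\<le>K.
      of_real (c a b) * unit_char (of_int (int a - int b) * \<theta> t j))"
    unfolding S_def of_real_sum power_cos_eq_sum_unit_char by (simp add: c_def)
  also have "\<dots> = (\<Sum>t\<in>T. \<Sum>a\<le>K. \<Sum>j\<in>J. \<Sum>b\<le>K.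
      of_real (c a b) * unit_char (of_int (int a - int b) * \<theta> t j))"
    by (intro sum.cong refl sum.swap)
  also have "\<dots> = (\<Sum>a\<le>K. \<Sum>t\<in>T. \<Sum>j\<in>J. \<Sum>b\<le>K.
      of_real (c a b) * unit_char (of_int (int a - int b) * \<theta> t j))"
    by (rule sum.swap)
  also have "\<dots> = (\<Sum>a\<le>K. \<Sum>t\<in>T. \<Sum>b\<le>K. \<Sum>j\<in>J.
      of_real (c a b) * unit_char (of_int (int a - int b) * \<theta> t j))"
    by (intro sum.cong refl sum.swap)
  also have "\<dots> = (\<Sum>a\<le>K. \<Sum>b\<le>K. \<Sum>t\<in>T. \<Sum>j\<in>J.
      of_real (c a b) * unit_char (of_int (int a - int b) * \<theta> t j))"
    by (intro sum.cong refl sum.swap)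
  also have "\<dots> = (\<Sum>a\<le>K. \<Sum>b\<le>K. of_real (c a b) * W (int a - int b))"
    by (simp add: W_def sum_distrib_left)
  finally have S: "complex_of_real S = (\<Sum>a\<le>K. \<Sum>b\<le>K. of_real (c a b) * W (int a - int b))" .
  have "complex_of_real D = (\<Sum>a\<le>K. of_real (c a a) * W 0)"
    by (simp add: D_def W0 c_def power2_eq_square sum_distrib_left mult_ac)
  also have "\<dots> = (\<Sum>a\<le>K. \<Sum>b\<le>K. of_real (c a b) * (if a = b then W 0 else 0))"
    by (intro sum.cong refl) (simp add: if_distrib[of "\<lambda>x. _ * x"] sum.delta cong: if_cong)
  finally have D: "complex_of_real D = (\<Sum>a\<le>K. \<Sum>b\<le>K. of_real (c a b) * (if a = b then W 0 else 0))" .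
  have "\<bar>S - D\<bar> = norm (complex_of_real S - complex_of_real D)"
    by (metis norm_of_real of_real_diff)
  also have "\<dots> = norm (\<Sum>a\<le>K. \<Sum>b\<le>K. of_real (c a b) * (W (int a - int b) - (if a = b then W 0 else 0)))"
    unfolding S D by (simp only: right_diff_distrib sum_subtractf)
  also have "\<dots> \<le> (\<Sum>a\<le>K. \<Sum>b\<le>K. c a b * B)"
  proof (intro sum_norm_le)
    fix a b assume "a \<in> {..K}" "b \<in> {..K}"
    then have "norm (W (int a - int b) - (if a = b then W 0 else 0)) \<le> B" using W_le by simp
    moreover have "c a b \<ge> 0" by (simp add: c_def)
    ultimately show "norm (of_real (c a b) * (W (int a - int b) - (if a = b then W 0 else 0))) \<le> c a b * B"
      by (simp add: norm_mult mult_left_mono)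
  qed
  also have "\<dots> = (\<Sum>a\<le>K. real (K choose a)) * (\<Sum>b\<le>K. real (K choose b)) * B"
    unfolding sum_product by (simp add: c_def sum_distrib_right)
  also have "\<dots> = 4 ^ K * B"
    by (simp add: sum_binomial flip: power_mult_distrib)
  finally have "S \<ge> D - 4 ^ K * B" by linarith
  moreover have "D \<ge> real (card T) * real (card J) * (4 ^ K / real (K + 1))"
    unfolding D_def by (intro mult_left_mono sum_binomial_squares_ge) auto
  ultimately show ?thesis
    unfolding S_def \<theta>_def B_def by (simp add: right_diff_distrib mult_ac)
qed

text \<open>M depends only on \<epsilon> and c. If all points stayed away from the integers, the
  test function would be at most \<open>(4 * \<rho>) ^ K\<close> at each of them, below the average
  that the previous bound guarantees.\<close>

lemma exists_dilate_near_int: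
  assumes "\<epsilon> > 0"
  shows "\<exists>M. \<forall>N (T :: nat set) (J :: nat set) \<beta>. J \<subseteq> {..<2 ^ N} \<and> M \<le> card J \<and> finite T \<and>
      inj_on (\<lambda>t. t mod 2 ^ N) T \<and> 2 ^ N \<le> card T * 2 ^ c \<longrightarrow>
      (\<exists>t\<in>T. \<exists>j\<in>J. \<exists>k::int. \<bar>\<beta> t + real t * real j / 2 ^ N - of_int k\<bar> < \<epsilon>)"
proof -
  define \<delta> where "\<delta> = min \<epsilon> (1 / 2)"
  have \<delta>: "0 < \<delta>" "\<delta> \<le> 1 / 2" "\<delta> \<le> \<epsilon>" using assms by (auto simp: \<delta>_def)
  define \<rho> where "\<rho> = (1 + cos (2 * pi * \<delta>)) / 2"
  have "cos (2 * pi * \<delta>) < cos 0" using \<delta> by (intro cos_monotone_0_pi) auto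
  then have "\<rho> < 1" by (simp add: \<rho>_def)
  moreover have "0 \<le> (1 + y) / 2" if "- 1 \<le> y" for y :: real
    using that by simp
  then have "0 \<le> \<rho>"
    unfolding \<rho>_def using cos_ge_minus_one by blast
  ultimately have \<rho>: "0 \<le> \<rho>" "\<rho> < 1" by auto
  have "(\<lambda>K. real K * \<rho> ^ K + \<rho> ^ K) \<longlonglongrightarrow> 0 + 0"
    using \<rho> by (intro tendsto_add powser_times_n_limit_0 LIMSEQ_power_zero) auto
  then have "\<forall>\<^sub>F K in sequentially. real K * \<rho> ^ K + \<rho> ^ K < 1 / 2"
    by (rule order_tendstoD) simp
  then obtain K where "real K * \<rho> ^ K + \<rho> ^ K < 1 / 2"
    unfolding eventually_sequentially by blast
  then have K: "real (K + 1) * \<rho> ^ K < 1 / 2" by (simp add: distrib_right)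
  \<comment> \<open>Since \<open>2 ^ N \<le> card T * 2 ^ c\<close>, this size of J makes the error
    B at most half of the main term P / (K + 1).\<close>
  define M where "M = 2 ^ (K + c) * (4 * (K + 1) ^ 2)"
  show ?thesis
  proof (intro exI[of _ M] allI impI, elim conjE)
    fix N and T J :: "nat set" and \<beta> :: "nat \<Rightarrow> real"
    assume J: "J \<subseteq> {..<2 ^ N}" "M \<le> card J" and T: "finite T" "inj_on (\<lambda>t. t mod 2 ^ N) T"
      and R: "(2::nat) ^ N \<le> card T * 2 ^ c"
    define P where "P = real (card T) * real (card J)"
    define B where "B = sqrt (real (card T) * 2 ^ N * real (card J) * 2 ^ K)"
    show "\<exists>t\<in>T. \<exists>j\<in>J. \<exists>k::int. \<bar>\<beta> t + real t * real j / 2 ^ N - of_int k\<bar> < \<epsilon>"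
    proof (rule ccontr)
      assume far: "\<not> ?thesis"
      have "(2 + 2 * cos (2 * pi * (\<beta> t + real t * real j / 2 ^ N))) ^ K \<le> (4 * \<rho>) ^ K"
        if "t \<in> T" "j \<in> J" for t j
      proof (rule power_mono)
        have "\<epsilon> \<le> \<bar>\<beta> t + real t * real j / 2 ^ N - of_int k\<bar>" for k :: int
          using far that by (meson not_less)
        then have "cos (2 * pi * (\<beta> t + real t * real j / 2 ^ N)) \<le> cos (2 * pi * \<delta>)"
          using \<delta> by (intro cos_le_cos_if_far_from_Ints) (auto intro: order_trans)
        then show "2 + 2 * cos (2 * pi * (\<beta> t + real t * real j / 2 ^ N)) \<le> 4 * \<rho>"
          by (simp add: \<rho>_def)
        show "0 \<le> 2 + 2 * cos (2 * pi * (\<beta> t + real t * real j / 2 ^ N))"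
          using cos_ge_minus_one[of "2 * pi * (\<beta> t + real t * real j / 2 ^ N)"] by linarith
      qed
      then have "(\<Sum>t\<in>T. \<Sum>j\<in>J. (2 + 2 * cos (2 * pi * (\<beta> t + real t * real j / 2 ^ N))) ^ K) \<le>
          (\<Sum>t\<in>T. \<Sum>j\<in>J. (4 * \<rho>) ^ K)"
        by (intro sum_mono)
      also have "\<dots> = 4 ^ K * (P * \<rho> ^ K)"
        by (simp add: P_def power_mult_distrib)
      finally have "4 ^ K * (P / real (K + 1) - B) \<le> 4 ^ K * (P * \<rho> ^ K)"
        using sum_power_cos_ge[OF J(1) T, of K \<beta>] unfolding P_def B_def by linarith
      then have main: "P / real (K + 1) - B \<le> P * \<rho> ^ K"
        by simp
      have "card J > 0" using J(2) by (auto simp: M_def intro: Nat.gr0I)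
      moreover have "card T > 0" using R by (auto intro: Nat.gr0I)
      ultimately have "P > 0" by (simp add: P_def)
      have "B \<le> sqrt ((P / (2 * real (K + 1)))\<^sup>2)"
        unfolding B_def
      proof (rule real_sqrt_le_mono)
        have "real (card T * 2 ^ N * card J * 2 ^ K * (4 * (K + 1) ^ 2)) \<le>
            real (card T * (card T * 2 ^ c) * card J * 2 ^ K * (4 * (K + 1) ^ 2))"
          by (intro of_nat_mono mult_le_mono R le_refl)
        also have "\<dots> = real (card T * card T * card J * M)"
          by (simp add: M_def power_add)
        also have "\<dots> \<le> real (card T * card T * card J * card J)"
          by (intro of_nat_mono mult_le_mono J le_refl)
        finally have "real (card T) * 2 ^ N * real (card J) * 2 ^ K * (4 * (real (K + 1))\<^sup>2) \<le> P\<^sup>2"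
          by (simp only: P_def of_nat_mult of_nat_power of_nat_numeral power2_eq_square mult_ac)
        moreover have "(P / (2 * real (K + 1)))\<^sup>2 = P\<^sup>2 / (4 * (real (K + 1))\<^sup>2)"
          by (simp only: power_divide power_mult_distrib) simp
        moreover have "0 < 4 * (real (K + 1))\<^sup>2" by simp
        ultimately show "real (card T) * 2 ^ N * real (card J) * 2 ^ K \<le> (P / (2 * real (K + 1)))\<^sup>2"
          by (simp only: pos_le_divide_eq)
      qed
      also have "\<dots> = P / (2 * real (K + 1))" using \<open>P > 0\<close> by simp
      finally have "P / (2 * real (K + 1)) \<le> P * \<rho> ^ K" using main by (simp add: field_simps)
      then have "P * (1 / (2 * real (K + 1))) \<le> P * \<rho> ^ K" by simp
      then have "1 / (2 * real (K + 1)) \<le> \<rho> ^ K"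
        using \<open>P > 0\<close> by (simp only: mult_le_cancel_left_pos)
      then show False using K by (simp add: field_simps)
    qed
  qed
qed

section \<open>Binary digits of irrational orbits\<close>

text \<open>The first L binary digits of the fractional part, read as one integer: the index of the
  dyadic interval of length \<open>2 ^ -L\<close> that contains y modulo 1.\<close>

definition dyadic_code :: "nat \<Rightarrow> real \<Rightarrow> nat" where
  "dyadic_code L y = nat \<lfloor>2 ^ L * frac y\<rfloor>"

lemma int_dyadic_code: "int (dyadic_code L y) = \<lfloor>2 ^ L * frac y\<rfloor>"
  by (simp add: dyadic_code_def)

lemma dyadic_code_le: "real (dyadic_code L y) \<le> 2 ^ L * frac y"
  using int_dyadic_code[of L y] by linarith

lemma less_dyadic_code: "2 ^ L * frac y < real (dyadic_code L y) + 1"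
  using int_dyadic_code[of L y] by linarith

lemma dyadic_code_less: "dyadic_code L y < 2 ^ L"
proof -
  have "real (dyadic_code L y) < 2 ^ L * 1"
    by (rule le_less_trans[OF dyadic_code_le]) (simp add: frac_lt_1)
  then show ?thesis by simp
qed

text \<open>Multiplication by \<open>2 ^ a\<close> shifts the binary expansion, so the digits after
  the first a are the leading digits of \<open>2 ^ a * y\<close>.\<close>

lemma dyadic_code_add:
  "dyadic_code (a + L) y = dyadic_code a y * 2 ^ L + dyadic_code L (2 ^ a * y)"
proof -
  let ?k = "\<lfloor>2 ^ a * frac y\<rfloor>"
  have "2 ^ a * y = 2 ^ a * frac y + of_int (2 ^ a * \<lfloor>y\<rfloor>)"
    by (simp add: frac_def algebra_simps)
  then have "frac (2 ^ a * y) = frac (2 ^ a * frac y)"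
    by (simp only: frac_add_of_int_right)
  then have shift: "2 ^ a * frac y = of_int ?k + frac (2 ^ a * y)"
    by (simp only: frac_def[of "2 ^ a * frac y"])
  have "2 ^ (a + L) * frac y = 2 ^ L * (2 ^ a * frac y)"
    by (simp add: power_add)
  also have "\<dots> = 2 ^ L * (of_int ?k + frac (2 ^ a * y))"
    by (rule arg_cong[OF shift])
  also have "\<dots> = of_int (?k * 2 ^ L) + 2 ^ L * frac (2 ^ a * y)"
    by (simp add: distrib_left)
  finally have "\<lfloor>2 ^ (a + L) * frac y\<rfloor> = ?k * 2 ^ L + \<lfloor>2 ^ L * frac (2 ^ a * y)\<rfloor>"
    by (simp only: floor_add_int[symmetric] add.commute[of "of_int _"])
  then have "int (dyadic_code (a + L) y) = int (dyadic_code a y * 2 ^ L + dyadic_code L (2 ^ a * y))"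
    by (simp add: int_dyadic_code)
  then show ?thesis by (simp only: of_nat_eq_iff)
qed

lemma dyadic_code_eq_imp_close:
  assumes "dyadic_code L y = dyadic_code L z"
  shows "\<bar>frac y - frac z\<bar> < 1 / 2 ^ L"
proof -
  have "\<bar>2 ^ L * frac y - 2 ^ L * frac z\<bar> < 1"
    using dyadic_code_le[of L y] less_dyadic_code[of L y] dyadic_code_le[of L z]
      less_dyadic_code[of L z] assms by linarith
  then have "2 ^ L * \<bar>frac y - frac z\<bar> < 1"
    by (simp add: abs_mult flip: right_diff_distrib)
  then show ?thesis by (simp add: field_simps)
qed

text \<open>Expansiveness of the doubling map at its fixed point \<open>0\<close>.\<close>

lemma in_Ints_if_doubling_orbit_near_Ints:
  fixes z :: real
  assumes "\<And>k. \<exists>m::int. \<bar>2 ^ k * z - of_int m\<bar> < 1 / 4"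
  shows "z \<in> \<int>"
proof -
  obtain m0 :: int where m0: "\<bar>z - of_int m0\<bar> < 1 / 4"
    using assms[of 0] by auto
  define \<eta> where "\<eta> = z - of_int m0"
  have small: "\<bar>2 ^ k * \<eta>\<bar> < 1 / 4" for k
  proof (induction k)
    case (Suc k)
    obtain m :: int where m: "\<bar>2 ^ Suc k * z - of_int m\<bar> < 1 / 4"
      using assms by blast
    have "2 ^ Suc k * z - of_int m = 2 * (2 ^ k * \<eta>) - of_int (m - 2 ^ Suc k * m0)"
      by (simp add: \<eta>_def algebra_simps)
    then have *: "\<bar>2 * (2 ^ k * \<eta>) - of_int (m - 2 ^ Suc k * m0)\<bar> < 1 / 4"
      using m by (simp only:)
    \<comment> \<open>The doubled quantity is below 1/2 in modulus and within 1/4 of this integer,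
      which must therefore be 0.\<close>
    then have "\<bar>real_of_int (m - 2 ^ Suc k * m0)\<bar> < 1"
      using Suc.IH by linarith
    then have "m - 2 ^ Suc k * m0 = 0" by linarith
    then show ?case using * by (simp add: mult.assoc)
  qed (use m0 in \<open>simp add: \<eta>_def\<close>)
  have "\<eta> = 0"
  proof (rule ccontr)
    assume "\<eta> \<noteq> 0"
    then obtain k where "1 / \<bar>\<eta>\<bar> < 2 ^ k"
      using real_arch_pow[of 2 "1 / \<bar>\<eta>\<bar>"] by auto
    then show False using small[of k] \<open>\<eta> \<noteq> 0\<close> by (simp add: field_simps abs_mult)
  qed
  then show ?thesis by (simp add: \<eta>_def)
qed

section \<open>Non-injectivity of doubling along an irrational orbit\<close>

text \<open>A repetition w(a) = w(a + d) propagates backwards down to n0. Pigeonhole yields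
  repetitions arbitrarily far out with some d \<le> B; as d may depend on the place, the common
  multiple \<open>fact B\<close> serves as period.\<close>

lemma backward_deterministic_imp_periodic:
  fixes w :: "nat \<Rightarrow> nat"
  assumes bound: "\<And>n. w n < B"
    and det: "\<And>m n. m \<ge> n0 \<Longrightarrow> n \<ge> n0 \<Longrightarrow> w (Suc m) = w (Suc n) \<Longrightarrow> w m = w n"
  obtains d where "d > 0" "\<And>n. n \<ge> n0 \<Longrightarrow> w (n + d) = w n"
proof -
  have pull_back: "w (n0 + l) = w (n0 + l + d)" if "w (n0 + l + i) = w (n0 + l + i + d)" for l i d
    using that
  proof (induction i)
    case (Suc i)
    then have "w (n0 + l + i) = w (n0 + l + i + d)"
      using det[of "n0 + l + i" "n0 + l + i + d"] by simp
    then show ?case by (rule Suc.IH)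
  qed simp
  have "w (n0 + l + fact B) = w (n0 + l)" for l
  proof -
    \<comment> \<open>The window starts \<open>fact B\<close> beyond the index of interest, so that
      the period d found there can be iterated up to a total shift of \<open>fact B\<close>.\<close>
    have "\<not> inj_on (\<lambda>i. w (n0 + l + fact B + i)) {..B}"
    proof (rule pigeonhole)
      have "card ((\<lambda>i. w (n0 + l + fact B + i)) ` {..B}) \<le> card {..<B}"
        by (rule card_mono) (use bound in auto)
      then show "card ((\<lambda>i. w (n0 + l + fact B + i)) ` {..B}) < card {..B}" by simp
    qed
    then obtain i j where ij: "i < j" "j \<le> B" "w (n0 + l + fact B + i) = w (n0 + l + fact B + j)"
      unfolding inj_on_def by (metis atMost_iff linorder_neqE_nat)
    define d where "d = j - i"
    have d: "1 \<le> d" "d \<le> B" "j = i + d" using ij by (auto simp: d_def)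
    have step: "w (n0 + l') = w (n0 + l' + d)" if "l' \<le> l + fact B" for l'
    proof (rule pull_back)
      have "n0 + l' + (l + fact B + i - l') = n0 + l + fact B + i" using that by simp
      then show "w (n0 + l' + (l + fact B + i - l')) = w (n0 + l' + (l + fact B + i - l') + d)"
        using ij(3) d(3) by (simp add: add.assoc)
    qed
    have iter: "q * d \<le> fact B \<Longrightarrow> w (n0 + l) = w (n0 + l + q * d)" for q
    proof (induction q)
      case (Suc q)
      then have "w (n0 + l) = w (n0 + (l + q * d))" by (simp add: add.assoc)
      also have "\<dots> = w (n0 + (l + q * d) + d)" using Suc.prems by (intro step) simp
      finally show ?case by (simp add: add_ac)
    qed simp
    have "d dvd fact B" using d by (intro dvd_fact) auto
    then obtain q where "fact B = q * d" by (metis dvd_def mult.commute)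
    then show ?thesis using iter[of q] by simp
  qed
  then have "w (n + fact B) = w n" if "n \<ge> n0" for n
    using that by (metis le_add_diff_inverse)
  then show thesis using that[of "fact B"] by simp
qed

lemma dyadic_code_orbit_step:
  "dyadic_code (Suc l) y = dyadic_code 1 y * 2 ^ l + dyadic_code (Suc l) (2 * y) div 2"
proof -
  have "dyadic_code (l + 1) (2 * y) = dyadic_code l (2 * y) * 2 ^ 1 + dyadic_code 1 (2 ^ l * (2 * y))"
    by (rule dyadic_code_add)
  then have "dyadic_code (Suc l) (2 * y) div 2 = dyadic_code l (2 * y)"
    using dyadic_code_less[of 1 "2 ^ l * (2 * y)"] by simp
  then show ?thesis using dyadic_code_add[of 1 l y] by simp
qed

text \<open>The doubling map is not injective on the limit set of an irrational orbit: an injective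
  expansive system would be eventually periodic.\<close>

lemma irrational_orbit_half_differences:
  fixes x :: real
  assumes "x \<notin> \<rat>" "\<delta> > 0"
  obtains n n' :: nat and k :: int where "n \<ge> n0" "n' \<ge> n0"
    "\<bar>2 ^ n * x - 2 ^ n' * x - (of_int k + 1 / 2)\<bar> < \<delta>"
proof -
  obtain L0 where L0: "1 / \<delta> < 2 ^ L0" using real_arch_pow[of 2 "1 / \<delta>"] by auto
  \<comment> \<open>L0 controls \<delta>; the extra 1 ensures that agreement in l + 1 digits means
    distance below 1/4, as expansiveness requires.\<close>
  define l where "l = L0 + 1"
  define w where "w n = dyadic_code (Suc l) (2 ^ n * x)" for n
  have w_Suc: "w n = dyadic_code 1 (2 ^ n * x) * 2 ^ l + w (Suc n) div 2" for n
    unfolding w_def using dyadic_code_orbit_step[of l "2 ^ n * x"] by (simp add: mult.assoc)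
  \<comment> \<open>Two orbit points with different first digits but nearly equal doubles differ by
    almost 1/2 modulo 1. Without such a pair, \<open>w (Suc n)\<close> would determine
    \<open>w n\<close>, and w would be eventually periodic.\<close>
  have "\<exists>n n'. n \<ge> n0 \<and> n' \<ge> n0 \<and> w (Suc n) = w (Suc n') \<and>
    dyadic_code 1 (2 ^ n * x) \<noteq> dyadic_code 1 (2 ^ n' * x)"
  proof (rule ccontr)
    assume no: "\<not> ?thesis"
    have det: "w m = w n" if "m \<ge> n0" "n \<ge> n0" "w (Suc m) = w (Suc n)" for m n
      using no that w_Suc[of m] w_Suc[of n] by metis
    have bound: "w n < 2 ^ Suc l" for n
      unfolding w_def by (rule dyadic_code_less)
    obtain d where d: "d > 0" "\<And>n. n \<ge> n0 \<Longrightarrow> w (n + d) = w n"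
      by (rule backward_deterministic_imp_periodic[OF bound det], assumption+, erule that, assumption)
    let ?z = "2 ^ n0 * (2 ^ d - 1) * x"
    have "?z \<in> \<int>"
    proof (rule in_Ints_if_doubling_orbit_near_Ints)
      fix k
      let ?a = "2 ^ (k + n0 + d) * x" and ?b = "2 ^ (k + n0) * x"
      have "\<bar>frac ?a - frac ?b\<bar> < 1 / 2 ^ Suc l"
        by (rule dyadic_code_eq_imp_close) (use d(2)[of "k + n0"] in \<open>simp add: w_def\<close>)
      also have "\<dots> \<le> 1 / 2 ^ 2" by (intro divide_left_mono power_increasing) (auto simp: l_def)
      finally have "\<bar>frac ?a - frac ?b\<bar> < 1 / 4" by simp
      moreover have "2 ^ k * ?z - of_int (\<lfloor>?a\<rfloor> - \<lfloor>?b\<rfloor>) = frac ?a - frac ?b"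
        by (simp add: frac_def power_add algebra_simps)
      ultimately show "\<exists>m::int. \<bar>2 ^ k * ?z - of_int m\<bar> < 1 / 4" by metis
    qed
    then have "?z \<in> \<rat>" by (auto elim!: Ints_cases)
    moreover have "(1::real) < 2 ^ d" using d(1) by (intro one_less_power) auto
    then have "(2::real) ^ d \<noteq> 1" by (rule less_imp_neq[symmetric])
    ultimately have "?z / (2 ^ n0 * (2 ^ d - 1)) \<in> \<rat>" by (intro Rats_divide) auto
    then show False using assms(1) \<open>(2::real) ^ d \<noteq> 1\<close> by simp
  qed
  then obtain n n' where n: "n \<ge> n0" "n' \<ge> n0" "w (Suc n) = w (Suc n')"
    "dyadic_code 1 (2 ^ n * x) \<noteq> dyadic_code 1 (2 ^ n' * x)" by blast
  have dbl: "2 * (2 ^ m * x) = of_int (int (dyadic_code 1 (2 ^ m * x)) + 2 * \<lfloor>2 ^ m * x\<rfloor>) + frac (2 ^ Suc m * x)" for m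
  proof -
    have "\<lfloor>2 ^ Suc m * x\<rfloor> = \<lfloor>2 * frac (2 ^ m * x) + of_int (2 * \<lfloor>2 ^ m * x\<rfloor>)\<rfloor>"
      by (simp add: frac_def algebra_simps)
    also have "\<dots> = int (dyadic_code 1 (2 ^ m * x)) + 2 * \<lfloor>2 ^ m * x\<rfloor>"
      by (simp only: floor_add_int[symmetric] int_dyadic_code) simp
    finally show ?thesis by (simp add: frac_def)
  qed
  have "dyadic_code 1 (2 ^ m * x) < 2" for m using dyadic_code_less[of 1] by simp
  \<comment> \<open>The first digits are 0 and 1 in some order, which makes the integer difference
    below odd.\<close>
  then have "dyadic_code 1 (2 ^ n * x) + dyadic_code 1 (2 ^ n' * x) = 1"
    using n(4) by (metis One_nat_def add.commute add_0 less_2_cases plus_1_eq_Suc)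
  then have "int (dyadic_code 1 (2 ^ n * x)) + int (dyadic_code 1 (2 ^ n' * x)) = 1"
    by (simp only: of_nat_1 flip: of_nat_add)
  then have "(int (dyadic_code 1 (2 ^ n * x)) + 2 * \<lfloor>2 ^ n * x\<rfloor>) -
      (int (dyadic_code 1 (2 ^ n' * x)) + 2 * \<lfloor>2 ^ n' * x\<rfloor>) =
      2 * (int (dyadic_code 1 (2 ^ n * x)) - 1 + \<lfloor>2 ^ n * x\<rfloor> - \<lfloor>2 ^ n' * x\<rfloor>) + 1"
    by (simp only: algebra_simps)
  then obtain k where k: "(int (dyadic_code 1 (2 ^ n * x)) + 2 * \<lfloor>2 ^ n * x\<rfloor>) -
      (int (dyadic_code 1 (2 ^ n' * x)) + 2 * \<lfloor>2 ^ n' * x\<rfloor>) = 2 * k + 1"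
    by blast
  have close: "\<bar>frac (2 ^ Suc n * x) - frac (2 ^ Suc n' * x)\<bar> < 1 / 2 ^ Suc l"
    by (rule dyadic_code_eq_imp_close) (use n(3) in \<open>simp only: w_def\<close>)
  have "2 * (2 ^ n * x - 2 ^ n' * x - (of_int k + 1 / 2)) =
      frac (2 ^ Suc n * x) - frac (2 ^ Suc n' * x)"
  proof -
    have "of_int (int (dyadic_code 1 (2 ^ n * x)) + 2 * \<lfloor>2 ^ n * x\<rfloor>) -
      of_int (int (dyadic_code 1 (2 ^ n' * x)) + 2 * \<lfloor>2 ^ n' * x\<rfloor>) = (2 * of_int k + 1 :: real)"
      using arg_cong[OF k, of real_of_int]
      by (simp only: of_int_diff of_int_add of_int_mult of_int_numeral of_int_1)
    then show ?thesis using dbl[of n] dbl[of n'] by argo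
  qed
  moreover have "\<bar>u\<bar> < b" if "2 * u = v" "\<bar>v\<bar> < b" for u v b :: real
    using that by linarith
  ultimately have "\<bar>2 ^ n * x - 2 ^ n' * x - (of_int k + 1 / 2)\<bar> < 1 / 2 ^ Suc l"
    using close by blast
  also have "\<dots> \<le> 1 / 2 ^ L0" by (simp add: l_def field_simps)
  also have "\<dots> < \<delta>" using L0 assms(2) by (simp add: field_simps)
  finally show thesis using that n by blast
qed

section \<open>Exponential growth of the number of occupied dyadic intervals\<close>

text \<open>For suitable y, y' in the orbit, \<open>2 ^ (N + c) * (y - y')\<close> is almost an odd
  integer. The codes of \<open>s i * y\<close> and \<open>s i * y'\<close> then determine
  \<open>s i\<close> modulo \<open>2 ^ (N + c)\<close> up to a rounding error in {-1, 0, 1}, hence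
  determine i below \<open>2 ^ N\<close>: two codes and three errors give the square and the factor
  3.\<close>

lemma card_dyadic_codes_ge:
  fixes x :: real
  assumes x: "x \<notin> \<rat>" and s: "two_adically_spread c s"
  shows "2 ^ N \<le> 3 * (card (dyadic_code (N + c) ` {2 ^ n * real (s i) * x | n i. n \<ge> 1}))\<^sup>2"
proof -
  let ?P = "dyadic_code (N + c) ` {2 ^ n * real (s i) * x | n i. n \<ge> 1}"
  define Q :: int where "Q = 2 ^ (N + c)"
  define S where "S = (\<Sum>i<2 ^ N. s i)"
  have s_le: "s i \<le> S" if "i < 2 ^ N" for i
    unfolding S_def by (rule member_le_sum) (use that in auto)
  have "1 / (2 * (real S + 1)) > 0" by simp
  then obtain n n' k where n: "n \<ge> N + c" "n' \<ge> N + c" and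
    k: "\<bar>2 ^ n * x - 2 ^ n' * x - (of_int k + 1 / 2)\<bar> < 1 / (2 * (real S + 1))"
    using irrational_orbit_half_differences[OF x] by metis
  \<comment> \<open>With this exponent \<open>2 ^ (N + c) * y\<close> is
    \<open>2 ^ (n + 1) * x\<close>, so the half-integer difference becomes an odd integer; n \<ge> N
    + c keeps l \<ge> 1.\<close>
  define l where "l = n + 1 - (N + c)"
  define l' where "l' = n' + 1 - (N + c)"
  define y where "y = 2 ^ l * x"
  define y' where "y' = 2 ^ l' * x"
  have Qy: "of_int Q * y = 2 * (2 ^ n * x)" "of_int Q * y' = 2 * (2 ^ n' * x)"
  proof -
    have "N + c + l = Suc n" "N + c + l' = Suc n'" using n by (auto simp: l_def l'_def)
    then have "(2::real) ^ (N + c) * 2 ^ l = 2 * 2 ^ n" "(2::real) ^ (N + c) * 2 ^ l' = 2 * 2 ^ n'"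
      by (simp_all flip: power_add)
    then show "of_int Q * y = 2 * (2 ^ n * x)" "of_int Q * y' = 2 * (2 ^ n' * x)"
      by (simp_all add: Q_def y_def y'_def flip: mult.assoc)
  qed
  define \<eta> where "\<eta> = of_int Q * y - of_int Q * y' - (2 * of_int k + 1)"
  have "\<bar>\<eta>\<bar> < 1 / (real S + 1)"
    using k unfolding \<eta>_def Qy by (simp add: field_simps)
  then have \<eta>: "(real S + 1) * \<bar>\<eta>\<bar> < 1" by (simp add: field_simps)
  let ?A = "\<lambda>i. dyadic_code (N + c) (real (s i) * y)"
  let ?B = "\<lambda>i. dyadic_code (N + c) (real (s i) * y')"
  have "\<exists>e m. e \<in> {- 1, 0, 1::int} \<and> int (?A i) - int (?B i) = int (s i) * (2 * k + 1) - Q * m + e"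
    if "i < 2 ^ N" for i
  proof -
    define m where "m = \<lfloor>real (s i) * y\<rfloor> - \<lfloor>real (s i) * y'\<rfloor>"
    define e where "e = int (?A i) - int (?B i) - (int (s i) * (2 * k + 1) - Q * m)"
    have "real (s i) * \<bar>\<eta>\<bar> \<le> (real S + 1) * \<bar>\<eta>\<bar>"
      using s_le[OF that] by (intro mult_right_mono) auto
    then have "\<bar>real (s i) * \<eta>\<bar> < 1" using \<eta> by (simp add: abs_mult)
    moreover have Q: "(2::real) ^ (N + c) = of_int Q" by (simp add: Q_def)
    have "2 ^ (N + c) * frac (real (s i) * y) - 2 ^ (N + c) * frac (real (s i) * y') =
        real (s i) * \<eta> + of_int (int (s i) * (2 * k + 1) - Q * m)"
      unfolding Q by (simp add: \<eta>_def m_def frac_def algebra_simps)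
    \<comment> \<open>The two floors contribute less than 1 in total, and so does
      \<open>s i * \<eta>\<close>.\<close>
    ultimately have "\<bar>real_of_int e\<bar> < 2"
      using dyadic_code_le[of "N + c" "real (s i) * y"] less_dyadic_code[of "N + c" "real (s i) * y"]
        dyadic_code_le[of "N + c" "real (s i) * y'"] less_dyadic_code[of "N + c" "real (s i) * y'"]
      unfolding e_def of_int_diff of_int_of_nat_eq by linarith
    then have "e \<in> {- 1, 0, 1}" by auto
    moreover have "int (?A i) - int (?B i) = int (s i) * (2 * k + 1) - Q * m + e"
      by (simp add: e_def)
    ultimately show ?thesis by blast
  qed
  then obtain e m where em: "\<And>i. i < 2 ^ N \<Longrightarrow> e i \<in> {- 1, 0, 1::int}"
    "\<And>i. i < 2 ^ N \<Longrightarrow> int (?A i) - int (?B i) = int (s i) * (2 * k + 1) - Q * m i + e i"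
    by metis
  have "inj_on (\<lambda>i. (?A i, ?B i, e i)) {..<2 ^ N}"
  proof (rule inj_onI)
    fix i j :: nat
    assume ij: "i \<in> {..<2 ^ N}" "j \<in> {..<2 ^ N}" and "(?A i, ?B i, e i) = (?A j, ?B j, e j)"
    then have "int (s i) * (2 * k + 1) - Q * m i = int (s j) * (2 * k + 1) - Q * m j"
      using em(2)[of i] em(2)[of j] by simp
    then have "(int (s i) - int (s j)) * (2 * k + 1) = Q * (m i - m j)"
      by (simp add: algebra_simps)
    then have "2 ^ (N + c) dvd (int (s i) - int (s j)) * (2 * k + 1)" by (simp add: Q_def)
    then have "2 ^ (N + c) dvd int (s i) - int (s j)"
      by (rule two_power_dvd_mult_odd[rotated]) simp
    then have "2 ^ N dvd int i - int j" using s by (simp add: two_adically_spread_def)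
    then have "int i mod 2 ^ N = int j mod 2 ^ N" by (simp add: mod_eq_dvd_iff)
    moreover have "int i < 2 ^ N" "int j < 2 ^ N" using ij by simp_all
    ultimately show "i = j" by simp
  qed
  moreover have "(\<lambda>i. (?A i, ?B i, e i)) ` {..<2 ^ N} \<subseteq> ?P \<times> ?P \<times> {- 1, 0, 1}"
  proof (rule image_subsetI)
    fix i :: nat assume i: "i \<in> {..<2 ^ N}"
    have "l \<ge> 1" "l' \<ge> 1" using n by (auto simp: l_def l'_def)
    moreover have "real (s i) * y = 2 ^ l * real (s i) * x" "real (s i) * y' = 2 ^ l' * real (s i) * x"
      by (simp_all add: y_def y'_def)
    ultimately have "?A i \<in> ?P" "?B i \<in> ?P" by blast+
    then show "(?A i, ?B i, e i) \<in> ?P \<times> ?P \<times> {- 1, 0, 1}"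
      using i by (intro SigmaI em(1)) auto
  qed
  moreover have "finite ?P"
    by (rule finite_subset[of _ "{..<2 ^ (N + c)}"]) (auto intro: dyadic_code_less)
  ultimately have "card {..<2 ^ N :: nat} \<le> card (?P \<times> ?P \<times> {- 1, 0, 1::int})"
    by (intro card_inj_on_le) auto
  then show ?thesis by (simp add: card_cartesian_product power2_eq_square algebra_simps)
qed

text \<open>A code of length N0 + L splits into a prefix j and a tail v, and v is again a code of C
  by invariance under doubling. Few prefixes for every tail would make the number of codes grow too
  slowly. N0 is fixed before L, so multipliers chosen from N0 stay bounded as L grows.\<close>

lemma large_dyadic_fibres:
  fixes C :: "real set"
  assumes dbl: "\<And>y. y \<in> C \<Longrightarrow> 2 * y \<in> C"
    and growth: "\<And>N. 2 ^ N \<le> 3 * (card (dyadic_code (N + c) ` C))\<^sup>2"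
  shows "\<exists>N0. \<forall>L0. \<exists>L\<ge>L0. \<exists>v. M \<le> card {j. j < 2 ^ N0 \<and> j * 2 ^ L + v \<in> dyadic_code (N0 + L) ` C}"
proof -
  obtain \<mu> where \<mu>: "M \<le> 2 ^ \<mu>" using less_exp[of M] by (metis less_imp_le)
  \<comment> \<open>Growth at rate \<open>2 ^ (N / 2)\<close> exceeds a factor
    \<open>2 ^ \<mu>\<close> per N0 digits exactly because N0 > 2 \<mu>.\<close>
  define N0 where "N0 = 2 * \<mu> + 1"
  define p where "p L = card (dyadic_code L ` C)" for L
  define F where "F L v = {j. j < 2 ^ N0 \<and> j * 2 ^ L + v \<in> dyadic_code (N0 + L) ` C}" for L v
  have dbl_power: "2 ^ a * y \<in> C" if "y \<in> C" for a y
    using that dbl by (induction a) (auto simp: mult.assoc)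
  have fin: "finite (dyadic_code L ` C)" for L
    by (rule finite_subset[of _ "{..<2 ^ L}"]) (auto intro: dyadic_code_less)
  have finF: "finite (F L v)" for L v by (simp add: F_def)
  have "\<exists>L\<ge>L0. \<exists>v. M \<le> card (F L v)" for L0
  proof (rule ccontr)
    assume no: "\<not> ?thesis"
    have small: "card (F L v) \<le> 2 ^ \<mu>" if "L \<ge> L0" for L v
      using no that \<mu> by (meson le_trans linorder_le_cases)
    have step: "p (N0 + L) \<le> 2 ^ \<mu> * p L" if L: "L \<ge> L0" for L
    proof -
      have "dyadic_code (N0 + L) ` C \<subseteq> (\<Union>v\<in>dyadic_code L ` C. (\<lambda>j. j * 2 ^ L + v) ` F L v)"
      proof safe
        fix y assume y: "y \<in> C"
        let ?v = "dyadic_code L (2 ^ N0 * y)"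
        have "dyadic_code N0 y \<in> F L ?v"
          using y by (auto simp: F_def dyadic_code_less simp flip: dyadic_code_add)
        moreover have "?v \<in> dyadic_code L ` C" using dbl_power[OF y] by blast
        ultimately show "dyadic_code (N0 + L) y \<in> (\<Union>v\<in>dyadic_code L ` C. (\<lambda>j. j * 2 ^ L + v) ` F L v)"
          unfolding dyadic_code_add by blast
      qed
      then have "p (N0 + L) \<le> card (\<Union>v\<in>dyadic_code L ` C. (\<lambda>j. j * 2 ^ L + v) ` F L v)"
        unfolding p_def by (rule card_mono[rotated])
          (rule finite_UN_I[OF fin finite_imageI[OF finF]])
      also have "\<dots> \<le> (\<Sum>v\<in>dyadic_code L ` C. card ((\<lambda>j. j * 2 ^ L + v) ` F L v))"
        by (rule card_UN_le) (rule fin)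
      also have "\<dots> \<le> (\<Sum>v\<in>dyadic_code L ` C. 2 ^ \<mu>)"
        by (intro sum_mono order_trans[OF card_image_le[OF finF]] small L)
      finally show ?thesis by (simp add: p_def mult.commute)
    qed
    have iter: "p (L0 + q * N0) \<le> 2 ^ (\<mu> * q + L0)" for q
    proof (induction q)
      case 0
      have "card (dyadic_code L0 ` C) \<le> card {..<2 ^ L0 :: nat}"
        by (rule card_mono) (auto intro: dyadic_code_less)
      then show ?case by (simp add: p_def)
    next
      case (Suc q)
      have "p (L0 + Suc q * N0) = p (N0 + (L0 + q * N0))" by (simp add: add_ac)
      also have "\<dots> \<le> 2 ^ \<mu> * p (L0 + q * N0)" by (rule step) simp
      also have "\<dots> \<le> 2 ^ \<mu> * 2 ^ (\<mu> * q + L0)" using Suc.IH by simp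
      finally show ?case by (simp add: power_add mult_ac)
    qed
    \<comment> \<open>This q makes the total length equal to e + 3 + c, so the two bounds collide as
      8 \<le> 3.\<close>
    define q where "q = L0 + c + 3"
    define e where "e = 2 * (\<mu> * q + L0)"
    have "L0 + q * N0 = (e + 3) + c" by (simp add: N0_def e_def q_def algebra_simps)
    then have "2 ^ (e + 3) \<le> 3 * (p (L0 + q * N0))\<^sup>2"
      using growth[of "e + 3"] by (simp only: p_def)
    also have "\<dots> \<le> 3 * (2 ^ (\<mu> * q + L0))\<^sup>2"
      using iter by (intro mult_le_mono2 power_mono) auto
    also have "\<dots> = 3 * 2 ^ e" by (simp add: e_def flip: power_mult power_even_eq)
    finally show False by (simp add: power_add)
  qed
  then show ?thesis unfolding F_def by blast
qed

section \<open>Density\<close>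

text \<open>Open sets of the quotient pull back to open sets of reals that are invariant under
  integer translation, so metric approximation modulo 1 suffices.\<close>

lemma dense_mod_oneI:
  assumes "\<And>\<alpha> \<epsilon>. \<epsilon> > 0 \<Longrightarrow> \<exists>s\<in>S. \<exists>k::int. \<bar>s - \<alpha> - of_int k\<bar> < \<epsilon>"
  shows "dense_mod_one S"
proof -
  have "\<exists>s\<in>S. mod_one s \<in> U" if "mod_one \<alpha> \<in> U" "openin circle_topology U" for \<alpha> U
  proof -
    have "open (mod_one -` U)" "\<alpha> \<in> mod_one -` U"
      using that by (auto simp: openin_circle_topology)
    then obtain \<epsilon> where \<epsilon>: "\<epsilon> > 0" "ball \<alpha> \<epsilon> \<subseteq> mod_one -` U"
      using openE by blast
    obtain s and k :: int where s: "s \<in> S" "\<bar>s - \<alpha> - of_int k\<bar> < \<epsilon>"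
      using assms[OF \<epsilon>(1)] by blast
    then have "s - of_int k \<in> ball \<alpha> \<epsilon>" by (simp add: dist_real_def abs_minus_commute algebra_simps)
    then have "mod_one (s - of_int k) \<in> U" using \<epsilon>(2) by blast
    moreover have "mod_one (s - of_int k) = mod_one s"
      unfolding mod_one_def by (rule equiv_class_eq[OF equiv_mod_one_rel]) (simp add: mod_one_rel_def)
    ultimately show ?thesis using s(1) by auto
  qed
  then have "topspace circle_topology \<subseteq> circle_topology closure_of (mod_one ` S)"
    by (auto simp: closure_of_def topspace_circle_topology simp flip: range_mod_one)
  then show ?thesis
    unfolding dense_mod_one_def by (simp add: closure_of_subset_topspace subset_antisym)
qed

lemma two_adically_spread_inj_on:
  assumes "two_adically_spread c t"
  shows "inj_on (\<lambda>i. t i mod 2 ^ N) {..<2 ^ (N - c)}"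
proof (cases "c \<le> N")
  case True
  show ?thesis
  proof (rule inj_onI)
    fix i j :: nat
    assume ij: "i \<in> {..<2 ^ (N - c)}" "j \<in> {..<2 ^ (N - c)}" "t i mod 2 ^ N = t j mod 2 ^ N"
    then have "int (t i) mod 2 ^ N = int (t j) mod 2 ^ N"
      by (metis of_nat_mod of_nat_numeral of_nat_power)
    then have "2 ^ (N - c + c) dvd int (t i) - int (t j)"
      using True by (simp add: mod_eq_dvd_iff)
    then have "2 ^ (N - c) dvd int i - int j"
      using assms by (simp add: two_adically_spread_def)
    then have "int i mod 2 ^ (N - c) = int j mod 2 ^ (N - c)" by (simp add: mod_eq_dvd_iff)
    moreover have "int i < 2 ^ (N - c)" "int j < 2 ^ (N - c)" using ij by simp_all
    ultimately show "i = j" by simp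
  qed
qed (auto simp: inj_on_def)

theorem dense_mod_one_two_adically_spread:
  fixes x :: real
  assumes x: "x \<notin> \<rat>" and s: "two_adically_spread c s" and t: "two_adically_spread d t"
  shows "dense_mod_one {2 ^ n * real (s i) * real (t j) * x | n i j. n \<ge> 1}"
proof (rule dense_mod_oneI)
  fix \<alpha> \<epsilon> :: real
  assume "\<epsilon> > 0"
  define C where "C = {2 ^ n * real (s i) * x | n i. n \<ge> 1}"
  have dbl: "2 * y \<in> C" if y: "y \<in> C" for y
  proof -
    obtain n i where "y = 2 ^ n * real (s i) * x" "n \<ge> 1" using y by (auto simp: C_def)
    then have "2 * y = 2 ^ Suc n * real (s i) * x" "Suc n \<ge> 1" by auto
    then show ?thesis unfolding C_def by blast
  qed
  have growth: "2 ^ N \<le> 3 * (card (dyadic_code (N + c) ` C))\<^sup>2" for N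
    unfolding C_def by (rule card_dyadic_codes_ge[OF x s])
  have "\<epsilon> / 2 > 0" using \<open>\<epsilon> > 0\<close> by simp
  then obtain M where
    M: "\<forall>N (T :: nat set) (J :: nat set) \<beta>. J \<subseteq> {..<2 ^ N} \<and> M \<le> card J \<and> finite T \<and>
      inj_on (\<lambda>t. t mod 2 ^ N) T \<and> 2 ^ N \<le> card T * 2 ^ d \<longrightarrow>
      (\<exists>t\<in>T. \<exists>j\<in>J. \<exists>k::int. \<bar>\<beta> t + real t * real j / 2 ^ N - of_int k\<bar> < \<epsilon> / 2)"
    using exists_dilate_near_int by blast
  obtain N0 where N0:
    "\<forall>L0. \<exists>L\<ge>L0. \<exists>v. M \<le> card {j. j < 2 ^ N0 \<and> j * 2 ^ L + v \<in> dyadic_code (N0 + L) ` C}"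
    using large_dyadic_fibres[OF dbl growth] by blast
  define T where "T = t ` {..<2 ^ (N0 - d)}"
  have finT: "finite T" by (simp add: T_def)
  have inj: "inj_on (\<lambda>i. t i mod 2 ^ N0) {..<2 ^ (N0 - d)}"
    using t by (rule two_adically_spread_inj_on)
  then have inj_t: "inj_on t {..<2 ^ (N0 - d)}" by (auto simp: inj_on_def)
  have injT: "inj_on (\<lambda>t. t mod 2 ^ N0) T"
    using inj by (auto simp: inj_on_def T_def)
  have "card T = 2 ^ (N0 - d)" using inj_t by (simp add: T_def card_image)
  then have cardT: "2 ^ N0 \<le> card T * 2 ^ d" by (simp flip: power_add)
  define S where "S = (\<Sum>r\<in>T. r)"
  have S: "r \<le> S" if "r \<in> T" for r
    unfolding S_def by (rule member_le_sum) (use that finT in auto)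
  obtain L0 where L0: "2 * real S / \<epsilon> < 2 ^ L0" using real_arch_pow[of 2 "2 * real S / \<epsilon>"] by auto
  obtain L v where L: "L \<ge> L0" and
    v: "M \<le> card {j. j < 2 ^ N0 \<and> j * 2 ^ L + v \<in> dyadic_code (N0 + L) ` C}"
    using N0 by blast
  \<comment> \<open>The shift \<open>\<beta>\<close> absorbs both the common tail v of the codes and
    the target \<alpha>.\<close>
  obtain r j k where r: "r \<in> T" and j: "j * 2 ^ L + v \<in> dyadic_code (N0 + L) ` C" and
    k: "\<bar>(real r * (real v / 2 ^ L) / 2 ^ N0 - \<alpha>) + real r * real j / 2 ^ N0 - of_int (k::int)\<bar> < \<epsilon> / 2"
    using M[rule_format, of "{j. j < 2 ^ N0 \<and> j * 2 ^ L + v \<in> dyadic_code (N0 + L) ` C}" N0 T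
        "\<lambda>r. real r * (real v / 2 ^ L) / 2 ^ N0 - \<alpha>"] v finT injT cardT by auto
  obtain y where y: "y \<in> C" and code: "j * 2 ^ L + v = dyadic_code (N0 + L) y" using j by blast
  define \<theta> where "\<theta> = 2 ^ (N0 + L) * frac y - real (j * 2 ^ L + v)"
  have \<theta>: "0 \<le> \<theta>" "\<theta> < 1"
    using dyadic_code_le[of "N0 + L" y] less_dyadic_code[of "N0 + L" y] by (auto simp: \<theta>_def code)
  have "real r * \<theta> \<le> real S * 1" using \<theta> S[OF r] by (intro mult_mono) auto
  \<comment> \<open>T depends on N0 only, so L could be taken large against all multipliers: the
    digits of y beyond its code move \<open>r * y\<close> by less than \<epsilon> / 2.\<close>
  also have "\<dots> < \<epsilon> / 2 * 2 ^ L0" using L0 \<open>\<epsilon> > 0\<close> by (simp add: field_simps)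
  also have "\<dots> \<le> \<epsilon> / 2 * 2 ^ (N0 + L)" using L \<open>\<epsilon> > 0\<close> by (intro mult_left_mono power_increasing) auto
  finally have "real r * \<theta> / 2 ^ (N0 + L) < \<epsilon> / 2" by (simp add: divide_less_eq)
  moreover have "0 \<le> real r * \<theta> / 2 ^ (N0 + L)" using \<theta> by simp
  moreover have "real r * y - \<alpha> - of_int (k + int r * \<lfloor>y\<rfloor>) =
      ((real r * (real v / 2 ^ L) / 2 ^ N0 - \<alpha>) + real r * real j / 2 ^ N0 - of_int k) +
      real r * \<theta> / 2 ^ (N0 + L)"
  proof -
    have "real j / 2 ^ N0 + real v / 2 ^ L / 2 ^ N0 + \<theta> / 2 ^ (N0 + L) = frac y"
      by (simp add: \<theta>_def power_add field_simps)
    then have "real r * (real j / 2 ^ N0 + real v / 2 ^ L / 2 ^ N0 + \<theta> / 2 ^ (N0 + L)) =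
        real r * (y - of_int \<lfloor>y\<rfloor>)"
      by (simp only: frac_def)
    then show ?thesis by (simp add: algebra_simps)
  qed
  moreover have "\<bar>w\<bar> < \<epsilon>" if "b < \<epsilon> / 2" "0 \<le> b" "w = a + b" "\<bar>a\<bar> < \<epsilon> / 2" for w a b :: real
    using that by linarith
  ultimately have "\<bar>real r * y - \<alpha> - of_int (k + int r * \<lfloor>y\<rfloor>)\<bar> < \<epsilon>"
    using k by blast
  moreover obtain n i where "y = 2 ^ n * real (s i) * x" "n \<ge> 1" using y by (auto simp: C_def)
  moreover obtain i' where "r = t i'" using r by (auto simp: T_def)
  ultimately have "\<bar>2 ^ n * real (s i) * real (t i') * x - \<alpha> - of_int (k + int r * \<lfloor>y\<rfloor>)\<bar> < \<epsilon>" "n \<ge> 1"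
    by (simp_all add: mult_ac)
  then show "\<exists>z\<in>{2 ^ n * real (s i) * real (t j) * x | n i j. n \<ge> 1}. \<exists>k::int. \<bar>z - \<alpha> - of_int k\<bar> < \<epsilon>"
    by blast
qed

lemma dense_mod_one_mono: "dense_mod_one A \<Longrightarrow> A \<subseteq> B \<Longrightarrow> dense_mod_one B"
  unfolding dense_mod_one_def
  by (metis closure_of_mono closure_of_subset_topspace image_mono subset_antisym)

theorem corollary4p9:
  fixes p1 p2 :: "int poly" and h1 h2 :: nat and x :: real
  assumes "degree p1 > 0" and "degree p2 > 0"
    and "\<And>m::nat. m \<ge> 1 \<Longrightarrow> poly p1 (int m) \<ge> 0"
    and "\<And>k::nat. k \<ge> 1 \<Longrightarrow> poly p2 (int k) \<ge> 0"
    and "h1 \<ge> 1" and "h2 \<ge> 1"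
    and "x \<notin> \<rat>"
  shows "dense_mod_one
    {2 ^ n * real (tower h1 (nat (poly p1 (int m)))) * real (tower h2 (nat (poly p2 (int k)))) * x
      | n m k :: nat. n \<ge> 1 \<and> m \<ge> 1 \<and> k \<ge> 1}"
proof -
  obtain c1 m1 where m1: "\<And>i. m1 i \<ge> (1::nat)"
    and s1: "two_adically_spread c1 (\<lambda>i. tower h1 (nat (poly p1 (int (m1 i)))))"
    using tower_poly_two_adically_spread[OF assms(1,3)] by metis
  obtain c2 m2 where m2: "\<And>i. m2 i \<ge> (1::nat)"
    and s2: "two_adically_spread c2 (\<lambda>i. tower h2 (nat (poly p2 (int (m2 i)))))"
    using tower_poly_two_adically_spread[OF assms(2,4)] by metis
  \<comment> \<open>The indices \<open>m1 i\<close> and \<open>m2 j\<close> are admissible m and k,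
    so a subset of the set is already dense.\<close>
  show ?thesis
    by (rule dense_mod_one_mono[OF dense_mod_one_two_adically_spread[OF assms(7) s1 s2]])
      (use m1 m2 in blast)
qed

end
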